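(* Let $\mathcal{C}=\{c_1,\ldots,c_m\}$ be a collection of cliques (vertex sets) with graph union $U$ on vertex set $V=c_1\cup\cdots\cup c_m$, and let $\Gamma_J$, $\gamma_J$ and signatures $f_H$ be as in the context. Let $\mathcal{I}_m$ be the set of all nonempty intersecting families $\mathcal{F}\subseteq\mathcal{P}(\{1,\ldots,m\})$. Define, in indeterminates $\mathbf{x}=(x_J : J\subseteq\{1,\ldots,m\})$, \[ \Phi(\mathbf{x})=\sum_{\mathcal{F}\in\mathcal{I}_m}\ \prod_{J\in\mathcal{F}}\left[(1+x_J)^{\gamma_J}-1\right]. \] Then $\Phi$ is the generating function for clique counts of $U$ by signature: for every function $\alpha:\mathcal{P}(\{1,\ldots,m\})\to\mathbb{N}_0$, the coefficient of $\prod_J x_J^{\alpha(J)}$ in $\Phi(\mathbf{x})$ equals the number of nonempty sets $H\subseteq V$ that induce a clique (complete subgraph) in $U$ and have signature $f_H=\alpha$.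
   Context: A clique is identified with its vertex set. For a collection $\mathcal{C}=\{c_1,\ldots,c_m\}$ of cliques of a graph, the graph union $U$ has vertex set $V=\bigcup_{j=1}^m c_j$, and distinct $u,v\in V$ are adjacent iff $u,v\in c_j$ for some $j$. For $J\subseteq\{1,\ldots,m\}$ let $\Gamma_J=\left(\bigcap_{j\in J}c_j\right)\setminus\left(\bigcup_{j\notin J}c_j\right)$ (with the empty intersection taken to be $V$), i.e. $\Gamma_J$ is the set of $v\in V$ with $\{j: v\in c_j\}=J$; let $\gamma_J=|\Gamma_J|$. For $H\subseteq V$, its signature is the function $f_H:\mathcal{P}(\{1,\ldots,m\})\to\mathbb{N}_0$, $f_H(J)=|H\cap\Gamma_J|$. A family $\mathcal{F}$ of subsets of $\{1,\ldots,m\}$ is intersecting if $A\cap B\neq\emptyset$ for all $A,B\in\mathcal{F}$. *)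

theory Defs
  imports Main "HOL-Library.Poly_Mapping" "HOL-Library.Ramsey"
begin

text \<open>
  A simple graph is a vertex set together with a set of two-element edges; cliques are those of
  \<^theory>\<open>HOL-Library.Ramsey\<close>. A collection of cliques is given as a family \<open>c\<close> indexed
  by \<open>{1..m}\<close>; values of \<open>c\<close> outside this range are irrelevant.
\<close>

definition union_verts :: "nat \<Rightarrow> (nat \<Rightarrow> 'v set) \<Rightarrow> 'v set" where
  "union_verts m c = (\<Union>j\<in>{1..m}. c j)"

definition union_edges :: "nat \<Rightarrow> (nat \<Rightarrow> 'v set) \<Rightarrow> 'v set set" where
  "union_edges m c =
     {{u, v} | u v. u \<in> union_verts m c \<and> v \<in> union_verts m c \<and> u \<noteq> v \<and>
                    (\<exists>j\<in>{1..m}. u \<in> c j \<and> v \<in> c j)}"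

text \<open>
  For \<open>J = {}\<close> the HOL intersection is \<^term>\<open>UNIV\<close>; intersecting with the vertex set implements the
  convention that the empty intersection is \<open>V\<close>, and is redundant for the other \<open>J \<subseteq> {1..m}\<close>.
\<close>

definition Gamma :: "nat \<Rightarrow> (nat \<Rightarrow> 'v set) \<Rightarrow> nat set \<Rightarrow> 'v set" where
  "Gamma m c J = (union_verts m c \<inter> (\<Inter>j\<in>J. c j)) - (\<Union>j\<in>{1..m} - J. c j)"

lemma Gamma_alt:
  assumes "J \<subseteq> {1..m}"
  shows "Gamma m c J = {v \<in> union_verts m c. {j \<in> {1..m}. v \<in> c j} = J}"
  using assms by (auto simp: Gamma_def)

definition signature :: "nat \<Rightarrow> (nat \<Rightarrow> 'v set) \<Rightarrow> 'v set \<Rightarrow> nat set \<Rightarrow> nat" where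
  "signature m c H J = card (H \<inter> Gamma m c J)"

definition intersecting :: "'a set set \<Rightarrow> bool" where
  "intersecting F \<longleftrightarrow> (\<forall>A\<in>F. \<forall>B\<in>F. A \<inter> B \<noteq> {})"

definition intersecting_families :: "nat \<Rightarrow> nat set set set" where
  "intersecting_families m = {F. F \<subseteq> Pow {1..m} \<and> F \<noteq> {} \<and> intersecting F}"

text \<open>
  Integer polynomials in indeterminates indexed by sets of naturals: finitely supported maps from
  exponent vectors to coefficients, multiplied by convolution. The coefficient of a monomial is
  obtained by \<^const>\<open>Poly_Mapping.lookup\<close> at its exponent vector.
\<close>

type_synonym set_poly = "(nat set \<Rightarrow>\<^sub>0 nat) \<Rightarrow>\<^sub>0 int"

definition X :: "nat set \<Rightarrow> set_poly" where
  "X J = Poly_Mapping.single (Poly_Mapping.single J 1) 1"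

definition expvec :: "nat \<Rightarrow> (nat set \<Rightarrow> nat) \<Rightarrow> (nat set \<Rightarrow>\<^sub>0 nat)" where
  "expvec m \<alpha> = (\<Sum>J\<in>Pow {1..m}. Poly_Mapping.single J (\<alpha> J))"

lemma X_power: "X J ^ n = Poly_Mapping.single (Poly_Mapping.single J n) 1"
  by (induction n) (simp_all add: X_def mult_single single_add[symmetric])

lemma single_expvec: "Poly_Mapping.single (expvec m \<alpha>) 1 = (\<Prod>J\<in>Pow {1..m}. X J ^ \<alpha> J)"
proof -
  have "Poly_Mapping.single (\<Sum>J\<in>S. Poly_Mapping.single J (\<alpha> J)) 1 = (\<Prod>J\<in>S. X J ^ \<alpha> J)"
    if "finite S" for S
    using that
  proof (induction S rule: finite_induct)
    case (insert J S)
    then show ?case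
      by (simp add: mult_single X_power[of J] flip: insert.IH)
  qed simp
  then show ?thesis
    by (simp add: expvec_def)
qed

definition Phi :: "nat \<Rightarrow> (nat \<Rightarrow> 'v set) \<Rightarrow> set_poly" where
  "Phi m c = (\<Sum>F\<in>intersecting_families m. \<Prod>J\<in>F. ((1 + X J) ^ card (Gamma m c J) - 1))"

end

theory Submission
  imports Defs
begin

text \<open>
  Let the type of a vertex be the set of indices of the cliques that contain it. Two distinct
  vertices are adjacent in the union iff their types meet, so a nonempty \<open>H\<close> is a clique iff the
  set of types occurring in \<open>H\<close> is an intersecting family. The factor \<open>(1 + x\<^sub>J)^\<gamma>\<^sub>J - 1\<close>
  enumerates the nonempty sets of vertices of type \<open>J\<close>, hence the product over \<open>F\<close> enumerates the
  vertex sets whose set of types is exactly \<open>F\<close>, each weighted by the monomial of its signature.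
\<close>

text \<open>Expanding the power amounts to choosing \<open>1\<close> or \<open>a\<close> for each
  element of \<open>A\<close>. In the induction, the subsets of \<open>insert v A\<close> split by
  whether they contain \<open>v\<close>.\<close>

lemma power_one_plus_card_eq_sum_Pow:
  fixes a :: "'a::comm_semiring_1"
  assumes "finite A"
  shows "(1 + a) ^ card A = (\<Sum>S\<in>Pow A. a ^ card S)"
  using assms
proof (induction A rule: finite_induct)
  case (insert v A)
  have disj: "Pow A \<inter> insert v ` Pow A = {}"
    using insert.hyps by auto
  have inj: "inj_on (insert v) (Pow A)"
    using insert.hyps by (auto simp: inj_on_def)
  have "(\<Sum>S\<in>insert v ` Pow A. a ^ card S) = (\<Sum>S\<in>Pow A. a ^ card (insert v S))"
    by (simp add: sum.reindex[OF inj])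
  also have "\<dots> = (\<Sum>S\<in>Pow A. a * a ^ card S)"
  proof (rule sum.cong)
    fix S assume "S \<in> Pow A"
    then have "finite S" "v \<notin> S"
      using insert.hyps by (auto intro: finite_subset)
    then show "a ^ card (insert v S) = a * a ^ card S"
      by simp
  qed simp
  finally have "(\<Sum>S\<in>Pow (insert v A). a ^ card S)
      = (\<Sum>S\<in>Pow A. a ^ card S) + (\<Sum>S\<in>Pow A. a * a ^ card S)"
    using insert.hyps by (simp add: Pow_insert sum.union_disjoint[OF _ _ disj])
  then show ?case
    using insert by (simp add: distrib_right sum_distrib_left sum.distrib)
qed simp

text \<open>A set with image \<open>insert J F\<close>, where \<open>J\<close> is not in
  \<open>F\<close>, is uniquely the disjoint union of a nonempty set of elements of type
  \<open>J\<close> and a set with image \<open>F\<close>. Weights multiply over this splitting,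
  which gives the induction on \<open>F\<close>.\<close>

lemma prod_one_plus_power_minus_one_eq_sum_image:
  fixes x :: "'b \<Rightarrow> 'a::comm_ring_1" and t :: "'v \<Rightarrow> 'b"
  assumes "finite V" "finite F"
  shows "(\<Prod>J\<in>F. (1 + x J) ^ card {v \<in> V. t v = J} - 1)
       = (\<Sum>H | H \<subseteq> V \<and> t ` H = F. \<Prod>v\<in>H. x (t v))"
  using assms(2)
proof (induction F rule: finite_induct)
  case empty
  have "{H. H \<subseteq> V \<and> t ` H = {}} = {{}}"
    by auto
  then show ?case
    by simp
next
  case (insert J F)
  define A where "A = {v \<in> V. t v = J}"
  define \<S> where "\<S> = Pow A - {{}}"
  define \<H> where "\<H> = {H. H \<subseteq> V \<and> t ` H = F}"
  have finA: "finite A"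
    using assms(1) by (simp add: A_def)
  \<comment> \<open>Subtracting 1 cancels the term of the empty set, so type \<open>J\<close> must
    really occur.\<close>
  have "(1 + x J) ^ card A - 1 = (\<Sum>S\<in>\<S>. x J ^ card S)"
    using finA by (simp add: power_one_plus_card_eq_sum_Pow \<S>_def sum_diff1)
  also have "\<dots> = (\<Sum>S\<in>\<S>. \<Prod>v\<in>S. x (t v))"
  proof (rule sum.cong)
    fix S assume "S \<in> \<S>"
    then have "(\<Prod>v\<in>S. x (t v)) = (\<Prod>v\<in>S. x J)"
      by (intro prod.cong) (auto simp: \<S>_def A_def)
    then show "x J ^ card S = (\<Prod>v\<in>S. x (t v))"
      by simp
  qed simp
  finally have "(\<Prod>J\<in>insert J F. (1 + x J) ^ card {v \<in> V. t v = J} - 1)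
      = (\<Sum>S\<in>\<S>. \<Prod>v\<in>S. x (t v)) * (\<Sum>H\<in>\<H>. \<Prod>v\<in>H. x (t v))"
    using insert by (simp add: A_def \<H>_def)
  also have "\<dots> = (\<Sum>(S, H)\<in>\<S> \<times> \<H>. (\<Prod>v\<in>S. x (t v)) * (\<Prod>v\<in>H. x (t v)))"
    by (simp add: sum_product sum.cartesian_product)
  also have "\<dots> = (\<Sum>H | H \<subseteq> V \<and> t ` H = insert J F. \<Prod>v\<in>H. x (t v))"
  proof (rule sum.reindex_bij_witness
      [where j = "\<lambda>(S, H). S \<union> H" and i = "\<lambda>H. (H \<inter> A, H - A)"], goal_cases)
    case (1 p)
    then show ?case
      using insert.hyps by (auto simp: \<S>_def \<H>_def A_def)
  next
    case (2 p)
    then show ?case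
      by (auto simp: \<S>_def \<H>_def A_def)
  next
    case (3 H)
    then show ?case
      by auto
  next
    case (4 H)
    then have H: "H \<subseteq> V" "t ` H = insert J F"
      by auto
    \<comment> \<open>This vertex makes \<open>H \<inter> A\<close> nonempty, as membership in
      \<open>\<S>\<close> demands.\<close>
    then obtain v where "v \<in> H" "t v = J"
      by (metis imageE insertI1)
    then have "H \<inter> A \<in> \<S>"
      using H by (auto simp: \<S>_def A_def)
    moreover have "t ` (H - A) = F"
      using H insert.hyps by (auto simp: A_def)
    ultimately show ?case
      using H by (auto simp: \<H>_def)
  next
    case (5 p)
    obtain S H where p: "p = (S, H)" "S \<in> \<S>" "H \<in> \<H>"
      using 5 by auto
    have "finite S" "finite H" "S \<inter> H = {}"
      using p insert.hyps assms(1) by (auto simp: \<S>_def \<H>_def A_def intro: finite_subset)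
    then show ?case
      by (simp add: p prod.union_disjoint)
  qed
  finally show ?case .
qed

definition clique_type :: "nat \<Rightarrow> (nat \<Rightarrow> 'v set) \<Rightarrow> 'v \<Rightarrow> nat set" where
  "clique_type m c v = {j \<in> {1..m}. v \<in> c j}"

lemma Gamma_eq_clique_type:
  "J \<subseteq> {1..m} \<Longrightarrow> Gamma m c J = {v \<in> union_verts m c. clique_type m c v = J}"
  by (simp add: Gamma_alt clique_type_def)

lemma lookup_expvec:
  "Poly_Mapping.lookup (expvec m \<alpha>) J = (if J \<in> Pow {1..m} then \<alpha> J else 0)"
  by (simp add: expvec_def Poly_Mapping.lookup_sum lookup_single when_def)

lemma expvec_eq_iff: "expvec m \<alpha> = expvec m \<beta> \<longleftrightarrow> (\<forall>J\<in>Pow {1..m}. \<alpha> J = \<beta> J)"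
  by (auto simp: poly_mapping_eq_iff fun_eq_iff lookup_expvec)

text \<open>Grouping the vertices of \<open>H\<close> by type collects, for each \<open>J\<close>,
  one factor \<open>X J\<close> per element of \<open>H \<inter> Gamma m c J\<close>.\<close>

lemma prod_X_eq_single_signature:
  assumes "finite H" "H \<subseteq> union_verts m c"
  shows "(\<Prod>v\<in>H. X (clique_type m c v)) = Poly_Mapping.single (expvec m (signature m c H)) 1"
proof -
  have "(\<Prod>v\<in>H. X (clique_type m c v)) 
      = (\<Prod>J\<in>Pow {1..m}. \<Prod>v | v \<in> H \<and> clique_type m c v = J. X (clique_type m c v))"
    using assms(1) by (intro prod.group[symmetric]) (auto simp: clique_type_def)
  also have "\<dots> = (\<Prod>J\<in>Pow {1..m}. X J ^ signature m c H J)"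
  proof (rule prod.cong)
    fix J assume "J \<in> Pow {1..m}"
    then have "H \<inter> Gamma m c J = {v \<in> H. clique_type m c v = J}"
      using assms(2) by (auto simp: Gamma_eq_clique_type)
    then show "(\<Prod>v | v \<in> H \<and> clique_type m c v = J. X (clique_type m c v))
        = X J ^ signature m c H J"
      by (simp add: signature_def)
  qed simp
  finally show ?thesis
    by (simp add: single_expvec)
qed

lemma clique_union_edges_iff:
  assumes "H \<subseteq> union_verts m c"
  shows "H \<noteq> {} \<and> clique H (union_edges m c)
     \<longleftrightarrow> clique_type m c ` H \<in> intersecting_families m"
proof -
  have edge: "{u, v} \<in> union_edges m c \<longleftrightarrow> clique_type m c u \<inter> clique_type m c v \<noteq> {}"
    if "u \<in> H" "v \<in> H" "u \<noteq> v" for u v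
  proof -
    have "{u, v} \<in> union_edges m c \<longleftrightarrow> (\<exists>j\<in>{1..m}. u \<in> c j \<and> v \<in> c j)"
      using that assms unfolding union_edges_def mem_Collect_eq doubleton_eq_iff by blast
    then show ?thesis
      by (auto simp: clique_type_def)
  qed
  \<comment> \<open>An intersecting family also compares each member with itself, so its members
    must be nonempty. This settles distinct vertices of equal type as well as the case
    \<open>u = v\<close>, on which \<open>clique\<close> imposes nothing.\<close>
  have loop: "clique_type m c v \<noteq> {}" if "v \<in> H" for v
    using that assms unfolding union_verts_def clique_type_def by blast
  have "clique H (union_edges m c) \<longleftrightarrow> intersecting (clique_type m c ` H)"
    unfolding clique_def intersecting_def ball_simps using edge loop by (metis Int_absorb)
  then show ?thesis
    by (auto simp: intersecting_families_def clique_type_def)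
qed

theorem theorem5p3:
  fixes W :: "'v set" and E :: "'v set set"
    and m :: nat and c :: "nat \<Rightarrow> 'v set"
  assumes "E \<subseteq> nsets W 2"
    and "\<And>j. j \<in> {1..m} \<Longrightarrow> finite (c j) \<and> c j \<subseteq> W \<and> clique (c j) E"
  shows "\<forall>\<alpha> :: nat set \<Rightarrow> nat.
    Poly_Mapping.lookup (Phi m c) (expvec m \<alpha>) =
      int (card {H. H \<subseteq> union_verts m c \<and> H \<noteq> {} \<and> clique H (union_edges m c) \<and>
                    (\<forall>J\<in>Pow {1..m}. signature m c H J = \<alpha> J)})"
proof
  fix \<alpha> :: "nat set \<Rightarrow> nat"
  let ?V = "union_verts m c" and ?t = "clique_type m c" and ?\<I> = "intersecting_families m"
  define \<H> where "\<H> = {H. H \<subseteq> ?V \<and> ?t ` H \<in> ?\<I>}"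
  have finV: "finite ?V"
    using assms(2) by (auto simp: union_verts_def)
  have fin\<H>: "finite \<H>"
    using finV by (simp add: \<H>_def)
  have fin\<I>: "finite ?\<I>"
    by (rule finite_subset[of _ "Pow (Pow {1..m})"]) (auto simp: intersecting_families_def)
  have "Phi m c = (\<Sum>F\<in>?\<I>. \<Sum>H | H \<subseteq> ?V \<and> ?t ` H = F. \<Prod>v\<in>H. X (?t v))"
    unfolding Phi_def
  proof (rule sum.cong)
    fix F assume "F \<in> ?\<I>"
    then have F: "F \<subseteq> Pow {1..m}"
      by (simp add: intersecting_families_def)
    have "(\<Prod>J\<in>F. (1 + X J) ^ card (Gamma m c J) - 1)
        = (\<Prod>J\<in>F. (1 + X J) ^ card {v \<in> ?V. ?t v = J} - 1)"
      using F by (intro prod.cong) (auto simp: Gamma_eq_clique_type)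
    also have "\<dots> = (\<Sum>H | H \<subseteq> ?V \<and> ?t ` H = F. \<Prod>v\<in>H. X (?t v))"
      using finV F by (intro prod_one_plus_power_minus_one_eq_sum_image)
        (auto intro: finite_subset)
    finally show "(\<Prod>J\<in>F. (1 + X J) ^ card (Gamma m c J) - 1)
        = (\<Sum>H | H \<subseteq> ?V \<and> ?t ` H = F. \<Prod>v\<in>H. X (?t v))" .
  qed simp
  \<comment> \<open>The inner index sets stay the same. Written as fibres of the image map on
    \<open>\<H>\<close>, they merge into a single sum by \<open>sum.group\<close>.\<close>
  also have "\<dots> = (\<Sum>F\<in>?\<I>. \<Sum>H | H \<in> \<H> \<and> ?t ` H = F. \<Prod>v\<in>H. X (?t v))"
    by (intro sum.cong) (auto simp: \<H>_def)
  also have "\<dots> = (\<Sum>H\<in>\<H>. \<Prod>v\<in>H. X (?t v))"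
    using fin\<H> fin\<I> by (intro sum.group) (auto simp: \<H>_def)
  also have "\<dots> = (\<Sum>H\<in>\<H>. Poly_Mapping.single (expvec m (signature m c H)) 1)"
    using finV by (intro sum.cong prod_X_eq_single_signature)
      (auto simp: \<H>_def intro: finite_subset)
  \<comment> \<open>Each \<open>H\<close> now contributes one monomial with coefficient 1, so the
    coefficient counts the \<open>H\<close> whose exponent vector equals that of \<alpha>.\<close>
  finally have "Poly_Mapping.lookup (Phi m c) (expvec m \<alpha>)
      = (\<Sum>H\<in>\<H>. if \<forall>J\<in>Pow {1..m}. signature m c H J = \<alpha> J then 1 else 0)"
    by (simp add: Poly_Mapping.lookup_sum lookup_single when_def expvec_eq_iff eq_commute[of "\<alpha> _"])
  also have "\<dots> = int (card {H \<in> \<H>. \<forall>J\<in>Pow {1..m}. signature m c H J = \<alpha> J})"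
    using fin\<H> by (simp add: sum.If_cases Int_def)
  also have "{H \<in> \<H>. \<forall>J\<in>Pow {1..m}. signature m c H J = \<alpha> J}
      = {H. H \<subseteq> ?V \<and> H \<noteq> {} \<and> clique H (union_edges m c) \<and>
            (\<forall>J\<in>Pow {1..m}. signature m c H J = \<alpha> J)}"
    unfolding \<H>_def using clique_union_edges_iff by blast
  finally show "Poly_Mapping.lookup (Phi m c) (expvec m \<alpha>) =
      int (card {H. H \<subseteq> ?V \<and> H \<noteq> {} \<and> clique H (union_edges m c) \<and>
                    (\<forall>J\<in>Pow {1..m}. signature m c H J = \<alpha> J)})" .
qed

end
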